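(* Let $V$ be a Euclidean space with orthonormal basis $\{x_1,\dots,x_n\}$, $n\ge 2$, and let $\mathcal{B}$ denote the Boolean system (for $W(A_{n-1})$ in (1), for $W(B_n)$ in (2)). (1) The map $(s_{x_i-x_{i+1}})_{\langle Y\rangle}\mapsto\sigma_{i,Y}$ (for $1\le i\le n-1$ and $\{i,i+1\}\subset Y\subset\{1,\dots,n\}$) induces an isomorphism from the Boolean reflection monoid $M(A_{n-1},\mathcal{B})$ to the symmetric inverse monoid $\mathscr{I}_n$. (2) The map $(s_{x_i})_{\langle Y\rangle}\mapsto\tau_{i,Y}$ (for $i\in Y\subset\{1,\dots,n\}$) and $(s_{x_i-x_{i+1}})_{\langle Y\rangle}\mapsto\mu_{i,Y}$ (for $1\le i\le n-1$ and $\{i,i+1\}\subset Y\subset\{1,\dots,n\}$) induces an isomorphism from the Boolean reflection monoid $M(B_n,\mathcal{B})$ to the monoid of partial signed permutations $\mathscr{J}_n$.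
   Context: Maps are written on the right. $s_x$ denotes the orthogonal reflection in $x^\perp$. $W(A_{n-1})$ is the group generated by the $s_{x_i-x_j}$ ($i\neq j$), and $W(B_n)$ the group generated by the $s_{x_i}$ and the $s_{x_i\pm x_j}$ ($i<j$). For $Y\subset X=\{1,\dots,n\}$, $\langle Y\rangle$ is the span of $\{x_i : i\in Y\}$, and $g_{\langle Y\rangle}$ is the restriction of a linear map $g$ to $\langle Y\rangle$. The Boolean system $\mathcal{B}$ for either group is the smallest collection of subspaces of $V$ containing $V$ and the coordinate hyperplanes $x_1^\perp,\dots,x_n^\perp$, invariant under the group, and closed under pairwise intersection; it equals $\{\langle Y\rangle : Y\subset X\}$. $M(A_{n-1},\mathcal{B})$ (resp. $M(B_n,\mathcal{B})$) is the monoid of all restrictions $g_{Z}$ with $g\in W(A_{n-1})$ (resp. $g\in W(B_n)$) and $Z\in\mathcal{B}$, under composition of partial maps. $\mathscr{I}_n$ is the monoid of all partial permutations of $X$ (bijections between subsets of $X$, including the empty map) under composition of partial functions. $\mathscr{J}_n$ is the submonoid of partial permutations $\sigma$ of $X\cup -X$ such that $x\in\mathrm{dom}\,\sigma\Leftrightarrow -x\in\mathrm{dom}\,\sigma$ and $(-x)\sigma=-(x\sigma)$. For $\{i,i+1\}\subset Y\subset X$, $\sigma_{i,Y}$ is the partial permutation with domain and image $Y$ that interchanges $i$ and $i+1$ and fixes the other points of $Y$. For $i\in Y\subset X$, $\tau_{i,Y}$ has domain and image $Y\cup -Y$ and acts as $(i,-i)$. For $\{i,i+1\}\subset Y\subset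 X$, $\mu_{i,Y}$ has domain and image $Y\cup -Y$ and acts as $(i,i+1)(-i,-(i+1))$. "Induces an isomorphism" means that there is a monoid isomorphism extending the given assignment. *)

theory Defs
  imports
    "HOL-Analysis.Analysis"
    "HOL-Algebra.Bij"
    "HOL-Algebra.Generated_Groups"
    "HOL-Combinatorics.Transposition"
begin

definition orthonormal_basis :: "nat \<Rightarrow> (nat \<Rightarrow> 'a::euclidean_space) \<Rightarrow> bool" where
  "orthonormal_basis n x \<longleftrightarrow>
     (\<forall>i\<in>{1..n}. \<forall>j\<in>{1..n}. inner (x i) (x j) = (if i = j then 1 else 0)) \<and>
     span (x ` {1..n}) = UNIV"

definition reflection :: "'a::euclidean_space \<Rightarrow> 'a \<Rightarrow> 'a" where
  "reflection a v = v - (2 * inner v a / inner a a) *\<^sub>R a"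

text \<open>The groups are generated inside the group of all bijections of the space. Its product
  applies the right factor first, opposite to maps written on the right, but a generated subgroup
  has the same elements under either convention.\<close>

definition weyl_A :: "nat \<Rightarrow> (nat \<Rightarrow> 'a::euclidean_space) \<Rightarrow> ('a \<Rightarrow> 'a) set" where
  "weyl_A n x = generate (BijGroup UNIV)
     {reflection (x i - x j) | i j. i \<in> {1..n} \<and> j \<in> {1..n} \<and> i \<noteq> j}"

definition weyl_B :: "nat \<Rightarrow> (nat \<Rightarrow> 'a::euclidean_space) \<Rightarrow> ('a \<Rightarrow> 'a) set" where
  "weyl_B n x = generate (BijGroup UNIV)
     ({reflection (x i) | i. i \<in> {1..n}} \<union>
      {reflection (x i + x j) | i j. i \<in> {1..n} \<and> j \<in> {1..n} \<and> i < j} \<union>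
      {reflection (x i - x j) | i j. i \<in> {1..n} \<and> j \<in> {1..n} \<and> i < j})"

inductive_set boolean_system ::
  "('a \<Rightarrow> 'a) set \<Rightarrow> nat \<Rightarrow> (nat \<Rightarrow> 'a::euclidean_space) \<Rightarrow> 'a set set"
  for W n x where
  whole: "UNIV \<in> boolean_system W n x"
| hyperplane: "i \<in> {1..n} \<Longrightarrow> orthogonal_comp {x i} \<in> boolean_system W n x"
| invariant: "Z \<in> boolean_system W n x \<Longrightarrow> g \<in> W \<Longrightarrow> g ` Z \<in> boolean_system W n x"
| inter: "Z \<in> boolean_system W n x \<Longrightarrow> Z' \<in> boolean_system W n x \<Longrightarrow>
    Z \<inter> Z' \<in> boolean_system W n x"

definition restriction :: "('a \<Rightarrow> 'a) \<Rightarrow> 'a set \<Rightarrow> 'a \<rightharpoonup> 'a" where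
  "restriction g Z = (Some \<circ> g) |` Z"

text \<open>Maps are written on the right, so in a product of partial maps the left factor acts first.\<close>

definition partial_map_monoid :: "('a \<rightharpoonup> 'a) set \<Rightarrow> 'a set \<Rightarrow> ('a \<rightharpoonup> 'a) monoid" where
  "partial_map_monoid C S =
     \<lparr>carrier = C, mult = (\<lambda>f g. g \<circ>\<^sub>m f), one = restriction id S\<rparr>"

definition reflection_monoid :: "('a \<Rightarrow> 'a) set \<Rightarrow> 'a set set \<Rightarrow> ('a \<rightharpoonup> 'a) monoid" where
  "reflection_monoid W \<B> = partial_map_monoid {restriction g Z | g Z. g \<in> W \<and> Z \<in> \<B>} UNIV"

definition boolean_monoid_A ::
  "nat \<Rightarrow> (nat \<Rightarrow> 'a::euclidean_space) \<Rightarrow> ('a \<rightharpoonup> 'a) monoid" where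
  "boolean_monoid_A n x = reflection_monoid (weyl_A n x) (boolean_system (weyl_A n x) n x)"

definition boolean_monoid_B ::
  "nat \<Rightarrow> (nat \<Rightarrow> 'a::euclidean_space) \<Rightarrow> ('a \<rightharpoonup> 'a) monoid" where
  "boolean_monoid_B n x = reflection_monoid (weyl_B n x) (boolean_system (weyl_B n x) n x)"

definition partial_perms :: "'b set \<Rightarrow> ('b \<rightharpoonup> 'b) set" where
  "partial_perms S = {\<sigma>. dom \<sigma> \<subseteq> S \<and> ran \<sigma> \<subseteq> S \<and> inj_on \<sigma> (dom \<sigma>)}"

definition symmetric_inverse_monoid :: "nat \<Rightarrow> (nat \<rightharpoonup> nat) monoid" where
  "symmetric_inverse_monoid n = partial_map_monoid (partial_perms {1..n}) {1..n}"

text \<open>The signed points of \<open>Y \<union> -Y\<close> are encoded as nonzero integers.\<close>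

definition signed :: "nat set \<Rightarrow> int set" where
  "signed Y = int ` Y \<union> uminus ` int ` Y"

definition partial_signed_perms :: "nat \<Rightarrow> (int \<rightharpoonup> int) set" where
  "partial_signed_perms n = {\<sigma> \<in> partial_perms (signed {1..n}).
     (\<forall>k. k \<in> dom \<sigma> \<longleftrightarrow> - k \<in> dom \<sigma>) \<and>
     (\<forall>k\<in>dom \<sigma>. the (\<sigma> (- k)) = - the (\<sigma> k))}"

definition signed_perm_monoid :: "nat \<Rightarrow> (int \<rightharpoonup> int) monoid" where
  "signed_perm_monoid n = partial_map_monoid (partial_signed_perms n) (signed {1..n})"

definition sigma_perm :: "nat \<Rightarrow> nat set \<Rightarrow> nat \<rightharpoonup> nat" where
  "sigma_perm i Y = restriction (Transposition.transpose i (i + 1)) Y"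

definition tau_perm :: "nat \<Rightarrow> nat set \<Rightarrow> int \<rightharpoonup> int" where
  "tau_perm i Y = restriction (Transposition.transpose (int i) (- int i)) (signed Y)"

definition mu_perm :: "nat \<Rightarrow> nat set \<Rightarrow> int \<rightharpoonup> int" where
  "mu_perm i Y = restriction
     (Transposition.transpose (int i) (int i + 1) \<circ>
      Transposition.transpose (- int i) (- (int i + 1))) (signed Y)"

text \<open>The library's \<open>iso\<close> presupposes neither that the two structures are monoids nor that the
  unit is preserved.\<close>

definition monoid_iso :: "('a, 'c) monoid_scheme \<Rightarrow> ('b, 'd) monoid_scheme \<Rightarrow> ('a \<Rightarrow> 'b) \<Rightarrow> bool"
  where
  "monoid_iso M N \<phi> \<longleftrightarrow> monoid M \<and> monoid N \<and> \<phi> \<in> iso M N \<and> \<phi> \<one>\<^bsub>M\<^esub> = \<one>\<^bsub>N\<^esub>"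

end

theory Submission
  imports Defs
begin

text \<open>
  Both isomorphisms have the same source: an element of the monoid is determined by what it does to
  a finite spanning frame that the group permutes. In type A the frame is the basis
  \<open>x 1, \<dots>, x n\<close>; in type B it is the set of vectors \<open>\<plusminus> x i\<close>, indexed by the signed integers.

  Reading a partial linear map off on the indices of the frame is \<open>frame_transport\<close>. It respects
  composition because frame vectors go to frame vectors. It is injective because every subspace of
  the Boolean system is spanned by the frame vectors it contains: these recover the domain, and the
  values on them determine the map by linearity. This argument does not see the type of the group
  and is carried out once, in \<open>reflection_monoid_iso\<close>.

  What depends on the type is the image. Each group maps every \<open>x i\<close> to some \<open>\<plusminus> x j\<close>, which is
  enough for the Boolean system to consist of the coordinate subspaces \<open>\<langle>Y\<rangle>\<close>
  (\<open>boolean_system_eq\<close>). So a partial permutation with domain \<open>Y\<close> can only come from a restriction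
  to \<open>\<langle>Y\<rangle>\<close>. Conversely a partial bijection of a finite set extends to a permutation of the whole
  set, permutations are products of transpositions, and the transpositions of the basis are the
  reflections in \<open>x i - x j\<close>: this settles type A (\<open>boolean_monoid_A_image\<close>). In type B the
  absolute values of a partial signed permutation form a partial permutation, to be extended as
  before, and the reflections in the \<open>x i\<close> then supply the signs (\<open>boolean_monoid_B_image\<close>).
\<close>

section \<open>Reflections and the groups they generate\<close>

lemma reflection_involution: "reflection a (reflection a v) = v"
  by (simp add: reflection_def inner_diff_left field_simps)

lemma orthogonal_transformation_reflection: "orthogonal_transformation (reflection a)"
  unfolding orthogonal_transformation_def
proof (intro conjI allI)
  show "linear (reflection a)"
    by (rule linearI)
      (auto simp: reflection_def inner_add_left scaleR_diff_right add_divide_distrib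
        scaleR_add_left distrib_left)
  show "reflection a v \<bullet> reflection a w = v \<bullet> w" for v w
    by (cases "a = 0")
      (auto simp: reflection_def inner_diff_left inner_diff_right inner_commute field_simps)
qed

lemma reflection_uminus: "reflection (- a) = reflection a"
  by (simp add: reflection_def fun_eq_iff)

lemma reflection_in_Bij: "reflection a \<in> carrier (BijGroup UNIV)"
proof -
  have "bij (reflection a)"
    by (rule o_bij[of "reflection a"]) (auto simp: fun_eq_iff reflection_involution)
  then show ?thesis by (simp add: BijGroup_def Bij_def)
qed

lemma generate_reflections_in_Bij:
  assumes "H \<subseteq> range reflection" "g \<in> generate (BijGroup UNIV) H"
  shows "g \<in> Bij UNIV"
proof -
  have "H \<subseteq> carrier (BijGroup UNIV)"
    using assms(1) reflection_in_Bij by blast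
  then show ?thesis
    using group.generate_in_carrier[OF group_BijGroup _ assms(2)] by (simp add: BijGroup_def)
qed

lemma BijGroup_UNIV_mult:
  "f \<in> Bij UNIV \<Longrightarrow> g \<in> Bij UNIV \<Longrightarrow> f \<otimes>\<^bsub>BijGroup UNIV\<^esub> g = f \<circ> g"
  by (auto simp: BijGroup_def compose_def fun_eq_iff)

lemma BijGroup_UNIV_one: "\<one>\<^bsub>BijGroup UNIV\<^esub> = id"
  by (auto simp: BijGroup_def fun_eq_iff)

lemma inv_reflection: "inv\<^bsub>BijGroup UNIV\<^esub> (reflection a) = reflection a"
proof (rule group.inv_equality[OF group_BijGroup])
  show "reflection a \<otimes>\<^bsub>BijGroup UNIV\<^esub> reflection a = \<one>\<^bsub>BijGroup UNIV\<^esub>"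
    using reflection_in_Bij[of a]
    by (subst BijGroup_UNIV_mult)
      (auto simp: BijGroup_UNIV_one reflection_involution fun_eq_iff BijGroup_def)
qed (rule reflection_in_Bij)+

lemma generate_reflections_id: "id \<in> generate (BijGroup UNIV) H"
  using generate.one[of "BijGroup UNIV" H] by (simp add: BijGroup_UNIV_one)

lemma generate_reflections_comp:
  assumes "H \<subseteq> range reflection"
    and "f \<in> generate (BijGroup UNIV) H" "g \<in> generate (BijGroup UNIV) H"
  shows "f \<circ> g \<in> generate (BijGroup UNIV) H"
  using generate.eng[OF assms(2,3)] generate_reflections_in_Bij[OF assms(1)] assms(2,3)
  by (simp add: BijGroup_UNIV_mult)

text \<open>Reflections are involutions, so every element is a product of generators and inverses need
  no case of their own.\<close>

lemma generate_reflections_induct [consumes 2, case_names id refl comp]: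
  assumes H: "H \<subseteq> range reflection"
    and g: "g \<in> generate (BijGroup UNIV) H"
    and id: "P id"
    and refl: "\<And>a. reflection a \<in> H \<Longrightarrow> P (reflection a)"
    and comp: "\<And>f h. P f \<Longrightarrow> P h \<Longrightarrow> P (f \<circ> h)"
  shows "P g"
  using g
proof (induction rule: generate.induct)
  case one
  then show ?case using id by (simp only: BijGroup_UNIV_one)
next
  case (incl h)
  then show ?case using H refl by auto
next
  case (inv h)
  then show ?case using H refl by (auto simp: inv_reflection)
next
  case (eng f h)
  then show ?case
    using comp generate_reflections_in_Bij[OF H] by (simp only: BijGroup_UNIV_mult)
qed

text \<open>The domain of a product of restrictions is \<open>Z \<inter> g -` Z'\<close>, so closure of the reflection monoid
  needs preimages, while the Boolean system is only closed under images by construction. For a single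
  reflection the two agree.\<close>

lemma boolean_system_preimage:
  assumes H: "H \<subseteq> range reflection"
    and g: "g \<in> generate (BijGroup UNIV) H"
    and Z: "Z \<in> boolean_system (generate (BijGroup UNIV) H) n x"
  shows "g -` Z \<in> boolean_system (generate (BijGroup UNIV) H) n x"
  using H g Z
proof (induction arbitrary: Z rule: generate_reflections_induct)
  case (refl a)
  have "reflection a -` Z = reflection a ` Z"
    by (metis (no_types, lifting) equalityI image_subset_iff subsetI vimageE vimageI
        reflection_involution rev_image_eqI)
  then show ?case
    using boolean_system.invariant[OF refl(2) generate.incl[OF refl(1)]] by simp
next
  case (comp f h)
  then show ?case by (simp only: vimage_comp[symmetric])
qed auto

section \<open>From partial linear maps to partial permutations\<close>

text \<open>For \<open>E\<close> injective on \<open>S\<close> this is conjugation of \<open>f\<close> by the indexing \<open>E\<close>. The choice made by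
  \<open>inv_into\<close> matters only if \<open>f\<close> leads out of the frame, which elements of the monoids do not.\<close>

definition frame_transport :: "('b \<Rightarrow> 'a) \<Rightarrow> 'b set \<Rightarrow> ('a \<rightharpoonup> 'a) \<Rightarrow> 'b \<rightharpoonup> 'b" where
  "frame_transport E S f =
     (\<lambda>k. if k \<in> S then map_option (inv_into S E) (f (E k)) else None)"

lemma restriction_apply: "restriction g Z v = (if v \<in> Z then Some (g v) else None)"
  by (simp add: restriction_def restrict_map_def)

lemma dom_restriction: "dom (restriction g Z) = Z"
  by (auto simp: dom_def restriction_apply split: if_splits)

lemma restriction_comp:
  "restriction g Z' \<circ>\<^sub>m restriction f Z = restriction (g \<circ> f) (Z \<inter> f -` Z')"
  by (auto simp: map_comp_def restriction_apply fun_eq_iff)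

text \<open>The way to compute a transported map: if \<open>g\<close> moves the frame as \<open>q\<close> moves the indices, then
  \<open>g\<close> on \<open>Z\<close> becomes \<open>q\<close> on the indices of the frame vectors in \<open>Z\<close>. It serves for the unit, for
  surjectivity and for the generators.\<close>

lemma frame_transport_restriction:
  assumes "inj_on E S"
    and "{k \<in> S. E k \<in> Z} = T"
    and "\<And>k. k \<in> T \<Longrightarrow> q k \<in> S \<and> g (E k) = E (q k)"
  shows "frame_transport E S (restriction g Z) = restriction q T"
proof
  fix k
  show "frame_transport E S (restriction g Z) k = restriction q T k"
    using assms by (auto simp: frame_transport_def restriction_apply)
qed

lemma frame_transport_map_comp:
  assumes "inj_on E S"
    and "\<And>k w. k \<in> S \<Longrightarrow> f (E k) = Some w \<Longrightarrow> w \<in> E ` S"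
  shows "frame_transport E S (h \<circ>\<^sub>m f) = frame_transport E S h \<circ>\<^sub>m frame_transport E S f"
proof
  fix k
  show "frame_transport E S (h \<circ>\<^sub>m f) k = (frame_transport E S h \<circ>\<^sub>m frame_transport E S f) k"
    using assms
    by (cases "f (E k)") (fastforce simp: frame_transport_def map_comp_def)+
qed

lemma frame_transport_partial_perm:
  assumes E: "inj_on E S" and g: "inj g" "g ` E ` S \<subseteq> E ` S"
  shows "frame_transport E S (restriction g Z) \<in> partial_perms S"
proof -
  define q where "q k = inv_into S E (g (E k))" for k
  have q: "q k \<in> S \<and> g (E k) = E (q k)" if "k \<in> S" for k
    using g(2) that unfolding q_def by (metis f_inv_into_f image_subset_iff imageI inv_into_into)
  have "frame_transport E S (restriction g Z) = restriction q {k \<in> S. E k \<in> Z}"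
    using q by (intro frame_transport_restriction E) auto
  moreover have "inj_on q S"
    by (metis E g(1) injD inj_onD inj_onI q)
  ultimately show ?thesis
    using q by (auto simp: partial_perms_def dom_restriction inj_on_def restriction_apply ran_def
        split: if_splits)
qed

lemma monoid_partial_map_monoid:
  fixes C :: "('a \<rightharpoonup> 'a) set"
  assumes "\<And>f. f \<in> C \<Longrightarrow> dom f \<subseteq> S \<and> ran f \<subseteq> S"
    and "restriction id S \<in> C"
    and "\<And>f h. f \<in> C \<Longrightarrow> h \<in> C \<Longrightarrow> h \<circ>\<^sub>m f \<in> C"
  shows "monoid (partial_map_monoid C S)"
proof (rule monoidI)
  fix f assume "f \<in> carrier (partial_map_monoid C S)"
  then have f: "dom f \<subseteq> S" "ran f \<subseteq> S" using assms(1) by (auto simp: partial_map_monoid_def)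
  have "f \<circ>\<^sub>m restriction id S = f"
  proof
    fix k show "(f \<circ>\<^sub>m restriction id S) k = f k"
      using f(1) by (cases "f k") (auto simp: map_comp_def restriction_apply dom_def)
  qed
  moreover have "restriction id S \<circ>\<^sub>m f = f"
  proof
    fix k show "(restriction id S \<circ>\<^sub>m f) k = f k"
      using f(2) by (cases "f k") (auto simp: map_comp_def restriction_apply ran_def)
  qed
  ultimately show "\<one>\<^bsub>partial_map_monoid C S\<^esub> \<otimes>\<^bsub>partial_map_monoid C S\<^esub> f = f"
    "f \<otimes>\<^bsub>partial_map_monoid C S\<^esub> \<one>\<^bsub>partial_map_monoid C S\<^esub> = f"
    by (auto simp: partial_map_monoid_def)
next
  fix f g h :: "'a \<rightharpoonup> 'a"
  have "h \<circ>\<^sub>m (g \<circ>\<^sub>m f) = (h \<circ>\<^sub>m g) \<circ>\<^sub>m f"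
    by (auto simp: map_comp_def fun_eq_iff split: option.split)
  then show "f \<otimes>\<^bsub>partial_map_monoid C S\<^esub> g \<otimes>\<^bsub>partial_map_monoid C S\<^esub> h =
      f \<otimes>\<^bsub>partial_map_monoid C S\<^esub> (g \<otimes>\<^bsub>partial_map_monoid C S\<^esub> h)"
    by (simp add: partial_map_monoid_def)
qed (simp_all add: partial_map_monoid_def assms(2,3))

text \<open>The type-independent core. Injectivity rests on \<open>B_span\<close>: the frame vectors in \<open>Z\<close> determine
  \<open>Z\<close>, and a linear map on \<open>Z\<close> is determined by its values on them. Surjectivity is built into the
  hypothesis \<open>image\<close>, which is what remains to be established for each group; that the target is a
  monoid then follows from the homomorphism property.\<close>

lemma reflection_monoid_iso:
  fixes W :: "('a::euclidean_space \<Rightarrow> 'a) set"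
  assumes E: "inj_on E S"
    and W_id: "id \<in> W"
    and W_comp: "\<And>f g. f \<in> W \<Longrightarrow> g \<in> W \<Longrightarrow> f \<circ> g \<in> W"
    and W_linear: "\<And>g. g \<in> W \<Longrightarrow> linear g"
    and W_frame: "\<And>g. g \<in> W \<Longrightarrow> g ` E ` S \<subseteq> E ` S"
    and B_UNIV: "UNIV \<in> B"
    and B_inter: "\<And>Z Z'. Z \<in> B \<Longrightarrow> Z' \<in> B \<Longrightarrow> Z \<inter> Z' \<in> B"
    and B_preimage: "\<And>g Z. g \<in> W \<Longrightarrow> Z \<in> B \<Longrightarrow> g -` Z \<in> B"
    and B_span: "\<And>Z. Z \<in> B \<Longrightarrow> span (Z \<inter> E ` S) = Z"
    and image: "frame_transport E S ` {restriction g Z | g Z. g \<in> W \<and> Z \<in> B} = C"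
  shows "monoid_iso (reflection_monoid W B) (partial_map_monoid C S) (frame_transport E S)"
proof -
  let ?\<phi> = "frame_transport E S"
  let ?M = "{restriction g Z | g Z. g \<in> W \<and> Z \<in> B}"
  have comp: "h \<circ>\<^sub>m f \<in> ?M" if "f \<in> ?M" "h \<in> ?M" for f h
  proof -
    obtain g Z g' Z' where "f = restriction g Z" "g \<in> W" "Z \<in> B"
      and "h = restriction g' Z'" "g' \<in> W" "Z' \<in> B"
      using \<open>f \<in> ?M\<close> \<open>h \<in> ?M\<close> by blast
    then have "h \<circ>\<^sub>m f = restriction (g' \<circ> g) (Z \<inter> g -` Z')" "g' \<circ> g \<in> W" "Z \<inter> g -` Z' \<in> B"
      by (simp_all only: restriction_comp W_comp B_inter B_preimage)
    then show ?thesis by blast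
  qed
  have one: "restriction id UNIV \<in> ?M"
    using W_id B_UNIV by blast
  have frame: "w \<in> E ` S" if "f \<in> ?M" "k \<in> S" "f (E k) = Some w" for f k w
  proof -
    obtain g Z where g: "f = restriction g Z" "g \<in> W"
      using \<open>f \<in> ?M\<close> by blast
    then have "w = g (E k)"
      using \<open>f (E k) = Some w\<close> by (simp add: restriction_apply split: if_splits)
    then show ?thesis
      using W_frame[OF g(2)] \<open>k \<in> S\<close> by blast
  qed
  have hom: "?\<phi> (h \<circ>\<^sub>m f) = ?\<phi> h \<circ>\<^sub>m ?\<phi> f" if "f \<in> ?M" for f h
    using frame[OF that] by (intro frame_transport_map_comp E)
  have \<phi>_one: "?\<phi> (restriction id UNIV) = restriction id S"
    using E by (intro frame_transport_restriction) auto
  have inj: "inj_on ?\<phi> ?M"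
  proof (rule inj_onI)
    fix f f' assume "f \<in> ?M" "f' \<in> ?M" and eq: "?\<phi> f = ?\<phi> f'"
    then obtain g Z g' Z' where f: "f = restriction g Z" "g \<in> W" "Z \<in> B"
      and f': "f' = restriction g' Z'" "g' \<in> W" "Z' \<in> B" by blast
    \<comment> \<open>The partial maps cannot be compared at \<open>E k\<close> directly, only after passing to indices;
      \<open>W_frame\<close> allows going back.\<close>
    have at: "map_option (inv_into S E) (f (E k)) = map_option (inv_into S E) (f' (E k))"
      if "k \<in> S" for k
      using fun_cong[OF eq, of k] that by (simp add: frame_transport_def)
    have "E k \<in> Z \<longleftrightarrow> E k \<in> Z'" if "k \<in> S" for k
      using at[OF that] by (auto simp: f f' restriction_apply split: if_splits)
    then have "Z \<inter> E ` S = Z' \<inter> E ` S" by auto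
    then have Z: "Z = Z'" using B_span f(3) f'(3) by metis
    have "g v = g' v" if v: "v \<in> Z \<inter> E ` S" for v
    proof -
      obtain k where k: "k \<in> S" "v = E k" using v by blast
      then have "inv_into S E (g v) = inv_into S E (g' v)"
        using at[of k] v by (auto simp: f f' Z restriction_apply)
      moreover have "g v \<in> E ` S" "g' v \<in> E ` S"
        using W_frame f(2) f'(2) k by blast+
      ultimately show ?thesis by (rule inv_into_injective)
    qed
    then have "g v = g' v" if "v \<in> Z" for v
      using linear_eq_on_span[OF W_linear W_linear, OF f(2) f'(2)] that B_span[OF f(3)] by blast
    then show "f = f'"
      by (auto simp: f f' Z restriction_apply)
  qed
  have "monoid (partial_map_monoid ?M UNIV)"
    using one comp by (intro monoid_partial_map_monoid) auto
  moreover have "monoid (partial_map_monoid C S)"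
  proof (rule monoid_partial_map_monoid)
    fix c assume "c \<in> C"
    then obtain f where f: "f \<in> ?M" "c = ?\<phi> f" using image by blast
    have "\<exists>l\<in>S. w = E l" if "k \<in> S" "f (E k) = Some w" for k w
      using frame[OF f(1) that] by blast
    then show "dom c \<subseteq> S \<and> ran c \<subseteq> S"
      using E by (fastforce simp: f(2) frame_transport_def ran_def dom_def split: if_splits)
  next
    show "restriction id S \<in> C"
      unfolding image[symmetric] \<phi>_one[symmetric] using one by (rule imageI)
  next
    fix c d assume "c \<in> C" "d \<in> C"
    then obtain f h where fh: "f \<in> ?M" "c = ?\<phi> f" "h \<in> ?M" "d = ?\<phi> h"
      using image by blast
    show "d \<circ>\<^sub>m c \<in> C"
      unfolding image[symmetric] fh(2,4) hom[OF fh(1), symmetric]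
      using comp[OF fh(1,3)] by (rule imageI)
  qed
  moreover have "?\<phi> \<in> iso (partial_map_monoid ?M UNIV) (partial_map_monoid C S)"
    unfolding iso_def hom_def bij_betw_def partial_map_monoid_def
    using inj image hom by auto
  ultimately show ?thesis
    using \<phi>_one by (simp add: monoid_iso_def reflection_monoid_def partial_map_monoid_def)
qed

section \<open>Orthonormal bases and coordinate subspaces\<close>

text \<open>Realises the integers that encode \<open>Y \<union> -Y\<close> as vectors \<open>\<plusminus> x i\<close>; the integer \<open>0\<close>, which
  encodes nothing, is sent to the zero vector.\<close>

definition signed_vector :: "(nat \<Rightarrow> 'a::euclidean_space) \<Rightarrow> int \<Rightarrow> 'a" where
  "signed_vector x k = of_int (sgn k) *\<^sub>R x (nat \<bar>k\<bar>)"

lemma signed_vector_minus: "signed_vector x (- k) = - signed_vector x k"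
  by (simp add: signed_vector_def sgn_minus)

lemma signed_iff: "k \<in> signed Y \<longleftrightarrow> nat \<bar>k\<bar> \<in> Y"
proof -
  have "k = int i \<or> k = - int i \<longleftrightarrow> nat \<bar>k\<bar> = i" for i
    by auto
  then show ?thesis
    by (auto simp: signed_def image_iff)
qed

text \<open>The complements of the domain and of the range have equally many elements, and any bijection
  between them completes \<open>f\<close>.\<close>

lemma extend_to_permutation:
  assumes "finite X" "Y \<subseteq> X" "inj_on f Y" "f ` Y \<subseteq> X"
  obtains p where "p permutes X" "\<And>i. i \<in> Y \<Longrightarrow> p i = f i"
proof -
  have "card (X - Y) = card (X - f ` Y)"
    using assms by (simp add: card_Diff_subset finite_subset card_image)
  then obtain h where h: "bij_betw h (X - Y) (X - f ` Y)"
    using finite_same_card_bij[of "X - Y" "X - f ` Y"] assms(1) by auto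
  define p where "p i = (if i \<in> Y then f i else if i \<in> X then h i else i)" for i
  have "bij_betw p Y (f ` Y)"
    using assms(3) by (auto simp: bij_betw_def p_def inj_on_def)
  moreover have "bij_betw p (X - Y) (X - f ` Y)"
    using h by (subst bij_betw_cong[of _ _ h]) (auto simp: p_def)
  ultimately have "bij_betw p (Y \<union> (X - Y)) (f ` Y \<union> (X - f ` Y))"
    by (rule bij_betw_combine) auto
  then have "bij_betw p X X"
    using assms(2,4) by (simp add: Un_absorb1)
  then have "p permutes X"
    using assms(2) by (intro bij_imp_permutes) (auto simp: p_def)
  then show ?thesis
    using that by (auto simp: p_def)
qed

context
  fixes n :: nat and x :: "nat \<Rightarrow> 'a::euclidean_space"
  assumes basis: "orthonormal_basis n x"
begin

lemma inner_basis: "i \<in> {1..n} \<Longrightarrow> j \<in> {1..n} \<Longrightarrow> x i \<bullet> x j = (if i = j then 1 else 0)"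
  using basis by (auto simp: orthonormal_basis_def)

lemma inj_basis: "inj_on x {1..n}"
  by (rule inj_onI) (metis inner_basis zero_neq_one)

text \<open>Describing \<open>\<langle>Y\<rangle>\<close> by equations turns intersections of coordinate subspaces into intersections of
  index sets, and exhibits \<open>\<langle>Y\<rangle>\<close> as an intersection of coordinate hyperplanes.\<close>

lemma coordinate_subspace:
  assumes Y: "Y \<subseteq> {1..n}"
  shows "span (x ` Y) = {v. \<forall>i\<in>{1..n} - Y. v \<bullet> x i = 0}"
proof
  have "subspace {v. \<forall>i\<in>{1..n} - Y. v \<bullet> x i = 0}"
    by (auto simp: subspace_def inner_add_left)
  moreover have "x ` Y \<subseteq> {v. \<forall>i\<in>{1..n} - Y. v \<bullet> x i = 0}"
    using Y by (force simp: inner_basis)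
  ultimately show "span (x ` Y) \<subseteq> {v. \<forall>i\<in>{1..n} - Y. v \<bullet> x i = 0}"
    by (rule span_minimal[rotated])
next
  show "{v. \<forall>i\<in>{1..n} - Y. v \<bullet> x i = 0} \<subseteq> span (x ` Y)"
  proof
    fix v assume v: "v \<in> {v. \<forall>i\<in>{1..n} - Y. v \<bullet> x i = 0}"
    have fin: "finite Y" using Y finite_subset by blast
    \<comment> \<open>The projection of \<open>v\<close> to \<open>\<langle>Y\<rangle>\<close>; the remainder \<open>v - u\<close> is orthogonal to the whole basis.\<close>
    define u where "u = (\<Sum>i\<in>Y. (v \<bullet> x i) *\<^sub>R x i)"
    have u: "u \<in> span (x ` Y)"
      unfolding u_def by (intro span_sum span_scale span_base) auto
    have "u \<bullet> x j = v \<bullet> x j" if "j \<in> {1..n}" for j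
    proof -
      have "u \<bullet> x j = (\<Sum>i\<in>Y. if i = j then v \<bullet> x i else 0)"
        unfolding u_def inner_sum_left using that Y
        by (intro sum.cong) (auto simp: inner_basis subset_iff)
      also have "\<dots> = v \<bullet> x j"
        using v that fin by (auto simp: sum.delta)
      finally show ?thesis .
    qed
    then have "orthogonal (v - u) w" if "w \<in> x ` {1..n}" for w
      using that by (auto simp: orthogonal_def inner_diff_left)
    moreover have "v - u \<in> span (x ` {1..n})"
      using basis by (simp add: orthonormal_basis_def)
    ultimately have "orthogonal (v - u) (v - u)"
      using orthogonal_to_span by blast
    then show "v \<in> span (x ` Y)"
      using u by (simp add: orthogonal_def)
  qed
qed

lemma basis_in_coordinate_subspace:
  "Y \<subseteq> {1..n} \<Longrightarrow> i \<in> {1..n} \<Longrightarrow> x i \<in> span (x ` Y) \<longleftrightarrow> i \<in> Y"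
  by (auto simp: coordinate_subspace inner_basis)

lemma image_coordinate_subspace:
  assumes g: "linear g" "\<And>i. i \<in> {1..n} \<Longrightarrow> \<exists>j\<in>{1..n}. g (x i) = x j \<or> g (x i) = - x j"
    and Y: "Y \<subseteq> {1..n}"
  shows "\<exists>Y'\<subseteq>{1..n}. g ` span (x ` Y) = span (x ` Y')"
proof -
  define Y' where "Y' = {j \<in> {1..n}. \<exists>i\<in>Y. g (x i) = x j \<or> g (x i) = - x j}"
  have "span (g ` x ` Y) = span (x ` Y')"
  proof (rule span_eq[THEN iffD2], intro conjI subsetI)
    fix w assume "w \<in> g ` x ` Y"
    then obtain i where i: "i \<in> Y" "w = g (x i)" by blast
    then obtain j where "j \<in> {1..n}" "w = x j \<or> w = - x j"
      using g(2) Y by blast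
    then have "j \<in> Y'" "w = x j \<or> w = - x j" using i by (auto simp: Y'_def)
    then show "w \<in> span (x ` Y')"
      by (auto intro: span_neg span_base)
  next
    fix w assume "w \<in> x ` Y'"
    then obtain j i where "w = x j" "i \<in> Y" "g (x i) = x j \<or> g (x i) = - x j"
      by (auto simp: Y'_def)
    then have "i \<in> Y" "w = g (x i) \<or> w = - g (x i)" by auto
    then show "w \<in> span (g ` x ` Y)"
      by (auto intro: span_neg span_base)
  qed
  then show ?thesis
    using linear_span_image[OF g(1)] by (intro exI[of _ Y']) (auto simp: Y'_def)
qed

text \<open>Only the shape of the group elements on the basis matters here, so one proof covers both
  types: images and intersections of coordinate subspaces are coordinate subspaces, and each of them
  is a finite intersection of hyperplanes.\<close>

lemma boolean_system_eq:
  assumes W: "\<And>g. g \<in> W \<Longrightarrow> linear g"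
    "\<And>g i. g \<in> W \<Longrightarrow> i \<in> {1..n} \<Longrightarrow> \<exists>j\<in>{1..n}. g (x i) = x j \<or> g (x i) = - x j"
  shows "boolean_system W n x = {span (x ` Y) | Y. Y \<subseteq> {1..n}}"
proof (intro subset_antisym subsetI)
  fix Z assume "Z \<in> boolean_system W n x"
  then have "\<exists>Y\<subseteq>{1..n}. Z = span (x ` Y)"
  proof induction
    case whole
    then show ?case using basis by (auto simp: orthonormal_basis_def)
  next
    case (hyperplane i)
    have "orthogonal_comp {x i} = span (x ` ({1..n} - {i}))"
      using hyperplane
      by (subst coordinate_subspace) (auto simp: orthogonal_comp_def orthogonal_def inner_commute)
    then show ?case by blast
  next
    case (invariant Z g)
    then show ?case
      using image_coordinate_subspace[OF W(1)[OF invariant(2)] W(2)[OF invariant(2)]] by metis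
  next
    case (inter Z Z')
    then obtain Y Y' where Y: "Y \<subseteq> {1..n}" "Z = span (x ` Y)" "Y' \<subseteq> {1..n}" "Z' = span (x ` Y')"
      by blast
    then have "Z \<inter> Z' = span (x ` (Y \<inter> Y'))"
      by (auto simp: coordinate_subspace le_infI1)
    then show ?case using Y by blast
  qed
  then show "Z \<in> {span (x ` Y) | Y. Y \<subseteq> {1..n}}" by blast
next
  fix Z assume "Z \<in> {span (x ` Y) | Y. Y \<subseteq> {1..n}}"
  then obtain Y where Y: "Y \<subseteq> {1..n}" "Z = span (x ` Y)" by blast
  have "{v. \<forall>i\<in>D. v \<bullet> x i = 0} \<in> boolean_system W n x" if "D \<subseteq> {1..n}" for D
    using finite_subset[OF that finite_atLeastAtMost] that
  proof (induction D rule: finite_induct)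
    case empty
    then show ?case using boolean_system.whole by simp
  next
    case (insert i D)
    have "{v. \<forall>i\<in>insert i D. v \<bullet> x i = 0} = orthogonal_comp {x i} \<inter> {v. \<forall>i\<in>D. v \<bullet> x i = 0}"
      by (auto simp: orthogonal_comp_def orthogonal_def inner_commute)
    then show ?case
      using insert by (simp add: boolean_system.inter boolean_system.hyperplane)
  qed
  then show "Z \<in> boolean_system W n x"
    unfolding Y(2) coordinate_subspace[OF Y(1)] by blast
qed

text \<open>Gives the spanning hypothesis of \<open>reflection_monoid_iso\<close>, as coordinate subspaces are spanned
  by part of the frame.\<close>

lemma span_Int_frame: "D \<subseteq> F \<Longrightarrow> span (span D \<inter> F) = span D"
  using span_mono[of D "span D \<inter> F"] span_mono[of "span D \<inter> F" "span D"] span_superset[of D]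
  by (auto simp: span_span)

lemma reflection_basis:
  assumes "i \<in> {1..n}" "k \<in> {1..n}"
  shows "reflection (x i) (x k) = (if k = i then - x k else x k)"
  using assms by (simp add: reflection_def inner_basis scaleR_2)

lemma reflection_difference:
  assumes "i \<in> {1..n}" "j \<in> {1..n}" "i \<noteq> j" "k \<in> {1..n}"
  shows "reflection (x i - x j) (x k) = x (Transposition.transpose i j k)"
  using assms
  by (auto simp: reflection_def inner_basis inner_diff_left inner_diff_right
      Transposition.transpose_def)

lemma reflection_sum:
  assumes "i \<in> {1..n}" "j \<in> {1..n}" "i \<noteq> j" "k \<in> {1..n}"
  shows "reflection (x i + x j) (x k) =
    (if k \<in> {i, j} then - x (Transposition.transpose i j k) else x k)"
  using assms
  by (auto simp: reflection_def inner_basis inner_add_left inner_add_right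
      Transposition.transpose_def)

section \<open>Permutations and the group of type A\<close>

lemma weyl_A_generators:
  "{reflection (x i - x j) | i j. i \<in> {1..n} \<and> j \<in> {1..n} \<and> i \<noteq> j} \<subseteq> range reflection"
  by auto

lemma weyl_A_permutes_basis:
  assumes "g \<in> weyl_A n x"
  shows "orthogonal_transformation g \<and> g ` x ` {1..n} \<subseteq> x ` {1..n}"
  using weyl_A_generators assms[unfolded weyl_A_def]
proof (induction rule: generate_reflections_induct)
  case (refl a)
  then obtain i j where a: "reflection a = reflection (x i - x j)" "i \<in> {1..n}" "j \<in> {1..n}" "i \<noteq> j"
    by blast
  have "Transposition.transpose i j k \<in> {1..n}" if "k \<in> {1..n}" for k
    using a that by (auto simp: Transposition.transpose_def)
  then show ?case
    using a orthogonal_transformation_reflection by (auto simp: reflection_difference)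
next
  case (comp f h)
  then show ?case
    using orthogonal_transformation_compose[of f h] image_mono[of "h ` x ` {1..n}" _ f]
    by (metis image_comp subset_trans)
qed (auto simp: orthogonal_transformation_def linear_id)

text \<open>Permutations of a finite set are products of transpositions, and the reflection in
  \<open>x a - x b\<close> acts on the basis as the transposition of \<open>a\<close> and \<open>b\<close>.\<close>

lemma weyl_A_realizes_permutation:
  assumes "p permutes {1..n}"
  shows "\<exists>g\<in>weyl_A n x. \<forall>i\<in>{1..n}. g (x i) = x (p i)"
  using finite_atLeastAtMost assms
proof (induction rule: permutes_rev_induct)
  case id
  then show ?case
    using generate_reflections_id by (auto simp: weyl_A_def intro!: bexI[of _ id])
next
  case (swap a b p)
  then obtain g where g: "g \<in> weyl_A n x" "\<And>i. i \<in> {1..n} \<Longrightarrow> g (x i) = x (p i)" by blast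
  let ?s = "reflection (x a - x b)"
  have "?s \<in> weyl_A n x"
    unfolding weyl_A_def using swap by (intro generate.incl) blast
  then have "g \<circ> ?s \<in> weyl_A n x"
    using g(1) weyl_A_generators generate_reflections_comp unfolding weyl_A_def by blast
  moreover have "(g \<circ> ?s) (x i) = x ((p \<circ> Transposition.transpose a b) i)"
    if "i \<in> {1..n}" for i
  proof -
    have "Transposition.transpose a b i \<in> {1..n}"
      using swap that by (auto simp: Transposition.transpose_def)
    then show ?thesis
      using swap that g(2) by (simp add: reflection_difference)
  qed
  ultimately show ?case by blast
qed

lemma boolean_system_A:
  "boolean_system (weyl_A n x) n x = {span (x ` Y) | Y. Y \<subseteq> {1..n}}"
proof (rule boolean_system_eq)
  fix g assume "g \<in> weyl_A n x"
  note g = weyl_A_permutes_basis[OF this]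
  show "linear g"
    using g orthogonal_transformation_linear by blast
  show "\<exists>j\<in>{1..n}. g (x i) = x j \<or> g (x i) = - x j" if "i \<in> {1..n}" for i
    using g that by (metis image_iff imageI subsetD)
qed

lemma frame_transport_coordinate_subspace:
  assumes "Y \<subseteq> {1..n}" "\<And>i. i \<in> Y \<Longrightarrow> q i \<in> {1..n} \<and> g (x i) = x (q i)"
  shows "frame_transport x {1..n} (restriction g (span (x ` Y))) = restriction q Y"
proof (rule frame_transport_restriction[OF inj_basis])
  show "{i \<in> {1..n}. x i \<in> span (x ` Y)} = Y"
    using basis_in_coordinate_subspace[OF assms(1)] assms(1) by blast
qed (rule assms(2))

text \<open>Restrictions of an injective map that permutes the basis give partial permutations. Conversely
  \<open>\<sigma>\<close> extends to a permutation, which some group element realises; restricting that element to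
  \<open>\<langle>dom \<sigma>\<rangle>\<close> gives \<open>\<sigma>\<close> back.\<close>

lemma boolean_monoid_A_image:
  "frame_transport x {1..n} `
     {restriction g Z | g Z. g \<in> weyl_A n x \<and> Z \<in> boolean_system (weyl_A n x) n x} =
   partial_perms {1..n}"
proof (intro subset_antisym subsetI)
  fix \<sigma> assume "\<sigma> \<in> frame_transport x {1..n} `
     {restriction g Z | g Z. g \<in> weyl_A n x \<and> Z \<in> boolean_system (weyl_A n x) n x}"
  then obtain g Z where "g \<in> weyl_A n x" "\<sigma> = frame_transport x {1..n} (restriction g Z)"
    by blast
  then show "\<sigma> \<in> partial_perms {1..n}"
    using weyl_A_permutes_basis orthogonal_transformation_inj
      frame_transport_partial_perm[OF inj_basis] by metis
next
  fix \<sigma> assume \<sigma>: "\<sigma> \<in> partial_perms {1..n}"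
  have the_\<sigma>: "the (\<sigma> i) \<in> {1..n}" "\<sigma> i = Some (the (\<sigma> i))" if "i \<in> dom \<sigma>" for i
    using \<sigma> that by (auto simp: partial_perms_def ran_def)
  have Y: "dom \<sigma> \<subseteq> {1..n}"
    using \<sigma> by (simp add: partial_perms_def)
  have "inj_on (\<lambda>i. the (\<sigma> i)) (dom \<sigma>)"
  proof (rule inj_onI)
    fix i j assume ij: "i \<in> dom \<sigma>" "j \<in> dom \<sigma>" and "the (\<sigma> i) = the (\<sigma> j)"
    then have "\<sigma> i = \<sigma> j" using the_\<sigma>(2) by metis
    then show "i = j" using \<sigma> ij by (auto simp: partial_perms_def dest: inj_onD)
  qed
  then obtain p where p: "p permutes {1..n}" "\<And>i. i \<in> dom \<sigma> \<Longrightarrow> p i = the (\<sigma> i)"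
    using extend_to_permutation[of "{1..n}" "dom \<sigma>" "\<lambda>i. the (\<sigma> i)"] Y the_\<sigma>(1) by blast
  then obtain g where g: "g \<in> weyl_A n x" "\<And>i. i \<in> {1..n} \<Longrightarrow> g (x i) = x (p i)"
    using weyl_A_realizes_permutation by blast
  have "frame_transport x {1..n} (restriction g (span (x ` dom \<sigma>))) =
      restriction (\<lambda>i. the (\<sigma> i)) (dom \<sigma>)"
    using Y g(2) p(2) the_\<sigma>(1) by (intro frame_transport_coordinate_subspace) (auto simp: subset_iff)
  also have "\<dots> = \<sigma>"
    using the_\<sigma>(2) by (auto simp: fun_eq_iff restriction_apply domIff)
  finally have "\<sigma> = frame_transport x {1..n} (restriction g (span (x ` dom \<sigma>)))" ..
  then show "\<sigma> \<in> frame_transport x {1..n} `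
     {restriction g Z | g Z. g \<in> weyl_A n x \<and> Z \<in> boolean_system (weyl_A n x) n x}"
    using g(1) Y unfolding boolean_system_A by blast
qed

lemma boolean_monoid_A_iso:
  "monoid_iso (boolean_monoid_A n x) (symmetric_inverse_monoid n) (frame_transport x {1..n})"
  unfolding boolean_monoid_A_def symmetric_inverse_monoid_def
proof (rule reflection_monoid_iso[OF inj_basis])
  show "id \<in> weyl_A n x"
    unfolding weyl_A_def by (rule generate_reflections_id)
  show "f \<circ> g \<in> weyl_A n x" if "f \<in> weyl_A n x" "g \<in> weyl_A n x" for f g
    using generate_reflections_comp[OF weyl_A_generators] that unfolding weyl_A_def by blast
  show "linear g" "g ` x ` {1..n} \<subseteq> x ` {1..n}" if "g \<in> weyl_A n x" for g
    using weyl_A_permutes_basis[OF that] orthogonal_transformation_linear by blast+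
  show "g -` Z \<in> boolean_system (weyl_A n x) n x"
    if "g \<in> weyl_A n x" "Z \<in> boolean_system (weyl_A n x) n x" for g Z
    using boolean_system_preimage[OF weyl_A_generators] that unfolding weyl_A_def by blast
  show "span (Z \<inter> x ` {1..n}) = Z" if "Z \<in> boolean_system (weyl_A n x) n x" for Z
    using that unfolding boolean_system_A by (auto simp only: intro!: span_Int_frame image_mono)
qed (fact boolean_system.whole boolean_system.inter boolean_monoid_A_image)+

section \<open>Signed permutations and the group of type B\<close>

lemma signed_vector_image:
  "v \<in> signed_vector x ` signed {1..n} \<longleftrightarrow> (\<exists>j\<in>{1..n}. v = x j \<or> v = - x j)"
proof
  assume "v \<in> signed_vector x ` signed {1..n}"
  then obtain k where "v = signed_vector x k" "nat \<bar>k\<bar> \<in> {1..n}"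
    by (auto simp: signed_iff)
  then show "\<exists>j\<in>{1..n}. v = x j \<or> v = - x j"
    by (intro bexI[of _ "nat \<bar>k\<bar>"]) (auto simp: signed_vector_def sgn_if)
next
  assume "\<exists>j\<in>{1..n}. v = x j \<or> v = - x j"
  then obtain j where j: "j \<in> {1..n}" "v = x j \<or> v = - x j" by blast
  then have "v = signed_vector x (int j) \<or> v = signed_vector x (- int j)"
    by (auto simp: signed_vector_def)
  moreover have "int j \<in> signed {1..n}" "- int j \<in> signed {1..n}"
    using j(1) by (auto simp: signed_iff)
  ultimately show "v \<in> signed_vector x ` signed {1..n}" by blast
qed

lemma inj_signed_vector: "inj_on (signed_vector x) (signed {1..n})"
proof (rule inj_onI)
  fix k l assume kl: "k \<in> signed {1..n}" "l \<in> signed {1..n}"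
    and eq: "signed_vector x k = signed_vector x l"
  \<comment> \<open>Pairing with \<open>x \<bar>k\<bar>\<close> reads off the sign, and detects whether the absolute values agree.\<close>
  have "signed_vector x k \<bullet> x (nat \<bar>k\<bar>) = of_int (sgn k)"
    "signed_vector x l \<bullet> x (nat \<bar>k\<bar>) = (if nat \<bar>l\<bar> = nat \<bar>k\<bar> then of_int (sgn l) else 0)"
    using kl by (auto simp: signed_iff signed_vector_def inner_basis)
  moreover have "sgn k \<noteq> 0"
    using kl by (auto simp: signed_iff sgn_eq_0_iff)
  ultimately have "nat \<bar>k\<bar> = nat \<bar>l\<bar> \<and> sgn k = sgn l"
    using eq by (metis of_int_eq_0_iff of_int_eq_iff)
  then show "k = l" by (metis abs_ge_zero abs_mult_sgn eq_nat_nat_iff)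
qed

lemma signed_vector_in_coordinate_subspace:
  assumes "Y \<subseteq> {1..n}" "k \<in> signed {1..n}"
  shows "signed_vector x k \<in> span (x ` Y) \<longleftrightarrow> k \<in> signed Y"
proof -
  have "k \<noteq> 0" "nat \<bar>k\<bar> \<in> {1..n}"
    using assms(2) by (auto simp: signed_iff)
  moreover have "- v \<in> span (x ` Y) \<longleftrightarrow> v \<in> span (x ` Y)" for v
    using span_neg[of v] span_neg[of "- v"] by auto
  ultimately show ?thesis
    using basis_in_coordinate_subspace[OF assms(1)]
    by (auto simp: signed_iff signed_vector_def sgn_if)
qed

lemma weyl_B_generators:
  "{reflection (x i) | i. i \<in> {1..n}} \<union>
   {reflection (x i + x j) | i j. i \<in> {1..n} \<and> j \<in> {1..n} \<and> i < j} \<union>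
   {reflection (x i - x j) | i j. i \<in> {1..n} \<and> j \<in> {1..n} \<and> i < j} \<subseteq> range reflection"
  by auto

lemma weyl_B_comp: "f \<in> weyl_B n x \<Longrightarrow> g \<in> weyl_B n x \<Longrightarrow> f \<circ> g \<in> weyl_B n x"
  using generate_reflections_comp[OF weyl_B_generators] unfolding weyl_B_def by blast

lemma weyl_B_permutes_signed_basis:
  assumes "g \<in> weyl_B n x"
  shows "orthogonal_transformation g \<and>
    (\<forall>i\<in>{1..n}. \<exists>j\<in>{1..n}. g (x i) = x j \<or> g (x i) = - x j)"
  using weyl_B_generators assms[unfolded weyl_B_def]
proof (induction rule: generate_reflections_induct)
  case (refl a)
  have transpose: "Transposition.transpose i j k \<in> {1..n}"
    if "i \<in> {1..n}" "j \<in> {1..n}" "k \<in> {1..n}" for i j k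
    using that by (auto simp: Transposition.transpose_def)
  have "\<exists>l\<in>{1..n}. reflection a (x k) = x l \<or> reflection a (x k) = - x l"
    if k: "k \<in> {1..n}" for k
    using refl(1)
  proof (elim UnE CollectE exE conjE)
    fix i assume "reflection a = reflection (x i)" "i \<in> {1..n}"
    then show ?thesis using k by (intro bexI[of _ k]) (auto simp: reflection_basis)
  next
    fix i j assume a: "reflection a = reflection (x i + x j)" "i \<in> {1..n}" "j \<in> {1..n}" "i < j"
    show ?thesis
    proof (cases "k \<in> {i, j}")
      case True
      then show ?thesis
        using a k transpose[OF a(2,3) k]
        by (intro bexI[of _ "Transposition.transpose i j k"]) (simp_all add: reflection_sum)
    next
      case False
      then show ?thesis
        using a k by (intro bexI[of _ k]) (simp_all add: reflection_sum)
    qed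
  next
    fix i j assume a: "reflection a = reflection (x i - x j)" "i \<in> {1..n}" "j \<in> {1..n}" "i < j"
    then show ?thesis
      using k transpose[OF a(2,3) k]
      by (intro bexI[of _ "Transposition.transpose i j k"]) (simp_all add: reflection_difference)
  qed
  then show ?case
    using orthogonal_transformation_reflection by blast
next
  case (comp f h)
  have f_minus: "f (- v) = - f v" for v
    using comp.IH(1) by (intro linear_neg orthogonal_transformation_linear) simp
  have "\<exists>j\<in>{1..n}. (f \<circ> h) (x i) = x j \<or> (f \<circ> h) (x i) = - x j" if i: "i \<in> {1..n}" for i
  proof -
    obtain j where j: "j \<in> {1..n}" "h (x i) = x j \<or> h (x i) = - x j"
      using comp.IH(2) i by blast
    moreover obtain l where "l \<in> {1..n}" "f (x j) = x l \<or> f (x j) = - x l"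
      using comp.IH(1) j(1) by blast
    ultimately show ?thesis
      by (intro bexI[of _ l]) (auto simp: f_minus)
  qed
  then show ?case
    using comp.IH orthogonal_transformation_compose[of f h] by blast
qed (auto simp: orthogonal_transformation_def linear_id)

lemma weyl_B_linear: "g \<in> weyl_B n x \<Longrightarrow> linear g"
  using weyl_B_permutes_signed_basis orthogonal_transformation_linear by blast

lemma boolean_system_B:
  "boolean_system (weyl_B n x) n x = {span (x ` Y) | Y. Y \<subseteq> {1..n}}"
  using weyl_B_linear weyl_B_permutes_signed_basis
  by (intro boolean_system_eq) blast+

lemma weyl_B_signed_frame:
  assumes "g \<in> weyl_B n x"
  shows "g ` signed_vector x ` signed {1..n} \<subseteq> signed_vector x ` signed {1..n}"
proof -
  have "g (- v) = - g v" for v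
    using weyl_B_linear[OF assms] by (rule linear_neg)
  then have "\<exists>j\<in>{1..n}. g w = x j \<or> g w = - x j"
    if "\<exists>j\<in>{1..n}. w = x j \<or> w = - x j" for w
    using weyl_B_permutes_signed_basis[OF assms] that by (metis minus_minus)
  then show ?thesis
    using signed_vector_image by blast
qed

text \<open>The generators of type A are indexed by all pairs \<open>i \<noteq> j\<close>, those of type B by \<open>i < j\<close> only;
  opposite vectors define the same reflection.\<close>

lemma weyl_A_subset_weyl_B: "weyl_A n x \<subseteq> weyl_B n x"
proof -
  have "reflection (x i - x j) = reflection (x j - x i)" for i j
    using reflection_uminus[of "x i - x j"] by simp
  then have "{reflection (x i - x j) | i j. i \<in> {1..n} \<and> j \<in> {1..n} \<and> i \<noteq> j} \<subseteq>
      {reflection (x i - x j) | i j. i \<in> {1..n} \<and> j \<in> {1..n} \<and> i < j}"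
    by clarify (metis nat_neq_iff)
  then show ?thesis
    unfolding weyl_A_def weyl_B_def
    by (intro group.mono_generate[OF group_BijGroup]) blast
qed

lemma weyl_B_realizes_sign_change:
  assumes "A \<subseteq> {1..n}"
  shows "\<exists>g\<in>weyl_B n x. \<forall>i\<in>{1..n}. g (x i) = (if i \<in> A then - x i else x i)"
  using finite_subset[OF assms finite_atLeastAtMost] assms
proof (induction A rule: finite_induct)
  case empty
  then show ?case
    using generate_reflections_id by (auto simp: weyl_B_def intro!: bexI[of _ id])
next
  case (insert a A)
  then obtain g where g: "g \<in> weyl_B n x"
    "\<And>i. i \<in> {1..n} \<Longrightarrow> g (x i) = (if i \<in> A then - x i else x i)" by auto
  have "reflection (x a) \<in> weyl_B n x"
    unfolding weyl_B_def using insert.prems by (intro generate.incl) blast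
  then have "g \<circ> reflection (x a) \<in> weyl_B n x"
    using g(1) weyl_B_comp by blast
  moreover have "g (- v) = - g v" for v
    using weyl_B_linear[OF g(1)] by (rule linear_neg)
  ultimately show ?case
    using insert g(2)
    by (intro bexI[of _ "g \<circ> reflection (x a)"]) (auto simp: reflection_basis)
qed

lemma weyl_B_realizes_signed_permutation:
  assumes p: "p permutes {1..n}" and A: "A \<subseteq> {1..n}"
  shows "\<exists>g\<in>weyl_B n x. \<forall>i\<in>{1..n}. g (x i) = (if i \<in> A then - x (p i) else x (p i))"
proof -
  obtain g where g: "g \<in> weyl_B n x" "\<And>i. i \<in> {1..n} \<Longrightarrow> g (x i) = x (p i)"
    using weyl_A_realizes_permutation[OF p] weyl_A_subset_weyl_B by blast
  obtain h where h: "h \<in> weyl_B n x"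
    "\<And>i. i \<in> {1..n} \<Longrightarrow> h (x i) = (if i \<in> A then - x i else x i)"
    using weyl_B_realizes_sign_change[OF A] by blast
  have "g (- v) = - g v" for v
    using weyl_B_linear[OF g(1)] by (rule linear_neg)
  then show ?thesis
    using g h weyl_B_comp[OF g(1) h(1)] by (intro bexI[of _ "g \<circ> h"]) auto
qed

lemma frame_transport_signed_coordinate_subspace:
  assumes "Y \<subseteq> {1..n}"
    and "\<And>k. k \<in> signed Y \<Longrightarrow>
      q k \<in> signed {1..n} \<and> g (signed_vector x k) = signed_vector x (q k)"
  shows "frame_transport (signed_vector x) (signed {1..n}) (restriction g (span (x ` Y))) =
    restriction q (signed Y)"
proof (rule frame_transport_restriction[OF inj_signed_vector])
  have "signed Y \<subseteq> signed {1..n}"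
    using assms(1) by (auto simp: signed_def)
  then show "{k \<in> signed {1..n}. signed_vector x k \<in> span (x ` Y)} = signed Y"
    using signed_vector_in_coordinate_subspace[OF assms(1)] by blast
qed (use assms in auto)

text \<open>Compatibility with signs is inherited from linearity, as \<open>signed_vector\<close> is odd. Conversely the
  absolute values of \<open>\<sigma>\<close> at the positive points of its domain form a partial permutation. Its extension
  to a permutation, with the signs of \<open>\<sigma>\<close> put in, is realised by a group element, and oddness
  carries the agreement with \<open>\<sigma>\<close> from positive to negative points.\<close>

lemma boolean_monoid_B_image:
  "frame_transport (signed_vector x) (signed {1..n}) `
     {restriction g Z | g Z. g \<in> weyl_B n x \<and> Z \<in> boolean_system (weyl_B n x) n x} =
   partial_signed_perms n"
  (is "?\<phi> ` ?M = _")
proof (intro subset_antisym subsetI)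
  fix \<sigma> assume "\<sigma> \<in> ?\<phi> ` ?M"
  then obtain g Y where g: "g \<in> weyl_B n x" and Y: "Y \<subseteq> {1..n}"
    and \<sigma>: "\<sigma> = ?\<phi> (restriction g (span (x ` Y)))"
    unfolding boolean_system_B by blast
  have g_orth: "orthogonal_transformation g"
    using weyl_B_permutes_signed_basis[OF g] by blast
  define q where "q k = inv_into (signed {1..n}) (signed_vector x) (g (signed_vector x k))" for k
  have q: "q k \<in> signed {1..n} \<and> g (signed_vector x k) = signed_vector x (q k)"
    if "k \<in> signed {1..n}" for k
  proof -
    have "g (signed_vector x k) \<in> signed_vector x ` signed {1..n}"
      using weyl_B_signed_frame[OF g] that by blast
    then show ?thesis
      unfolding q_def by (simp add: inv_into_into f_inv_into_f)
  qed
  have minus: "- k \<in> signed Y' \<longleftrightarrow> k \<in> signed Y'" for k Y'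
    by (simp add: signed_iff)
  have sub: "signed Y \<subseteq> signed {1..n}"
    using Y by (auto simp: signed_def)
  have q_minus: "q (- k) = - q k" if k: "k \<in> signed {1..n}" for k
  proof (rule inj_onD[OF inj_signed_vector])
    have "signed_vector x (q (- k)) = g (signed_vector x (- k))"
      using q k minus by metis
    also have "\<dots> = - g (signed_vector x k)"
      using linear_neg[OF orthogonal_transformation_linear[OF g_orth]]
      by (simp add: signed_vector_minus)
    also have "\<dots> = signed_vector x (- q k)"
      using q k by (simp add: signed_vector_minus)
    finally show "signed_vector x (q (- k)) = signed_vector x (- q k)" .
  qed (use q k minus in auto)
  have \<sigma>_q: "\<sigma> = restriction q (signed Y)"
    unfolding \<sigma> using Y q sub by (intro frame_transport_signed_coordinate_subspace) auto
  have "\<sigma> \<in> partial_perms (signed {1..n})"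
    unfolding \<sigma> using orthogonal_transformation_inj[OF g_orth] weyl_B_signed_frame[OF g]
    by (intro frame_transport_partial_perm inj_signed_vector)
  then show "\<sigma> \<in> partial_signed_perms n"
    using q_minus sub minus
    by (auto simp: partial_signed_perms_def \<sigma>_q dom_restriction restriction_apply)
next
  fix \<sigma> assume \<sigma>: "\<sigma> \<in> partial_signed_perms n"
  define Y where "Y = {i. int i \<in> dom \<sigma>}"
  define t where "t k = the (\<sigma> k)" for k
  have dom: "dom \<sigma> \<subseteq> signed {1..n}" and inj: "inj_on \<sigma> (dom \<sigma>)"
    and dom_minus: "\<And>k. - k \<in> dom \<sigma> \<longleftrightarrow> k \<in> dom \<sigma>"
    and t_minus: "\<And>k. k \<in> dom \<sigma> \<Longrightarrow> t (- k) = - t k"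
    using \<sigma> by (auto simp: partial_signed_perms_def partial_perms_def t_def)
  have t: "t k \<in> signed {1..n}" "\<sigma> k = Some (t k)" if "k \<in> dom \<sigma>" for k
    using \<sigma> that by (auto simp: partial_signed_perms_def partial_perms_def t_def ran_def)
  have Y: "Y \<subseteq> {1..n}"
  proof
    fix i assume "i \<in> Y"
    then have "int i \<in> signed {1..n}" using dom by (auto simp: Y_def)
    then show "i \<in> {1..n}" by (simp add: signed_iff)
  qed
  have signed_Y: "signed Y = dom \<sigma>"
  proof (rule Set.set_eqI)
    fix k show "k \<in> signed Y \<longleftrightarrow> k \<in> dom \<sigma>"
      using dom_minus[of k] by (cases "0 \<le> k") (simp_all add: signed_iff Y_def)
  qed
  have "inj_on (\<lambda>i. nat \<bar>t (int i)\<bar>) Y"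
  proof (rule inj_onI)
    fix i j assume ij: "i \<in> Y" "j \<in> Y" and eq: "nat \<bar>t (int i)\<bar> = nat \<bar>t (int j)\<bar>"
    \<comment> \<open>Equal absolute values mean that \<open>i\<close> has the same image as \<open>j\<close> or as \<open>-j\<close>, and positive
      \<open>i\<close> and \<open>j\<close> rule out \<open>i = -j\<close>.\<close>
    have d: "int i \<in> dom \<sigma>" "int j \<in> dom \<sigma>" "- int j \<in> dom \<sigma>"
      using ij dom_minus by (auto simp: Y_def)
    have "t (int i) = t (int j) \<or> t (int i) = t (- int j)"
      using eq t_minus[OF d(2)] by linarith
    then have "int i = int j \<or> int i = - int j"
      using d t(2) inj by (metis inj_onD)
    then show "i = j" by linarith
  qed
  moreover have "(\<lambda>i. nat \<bar>t (int i)\<bar>) ` Y \<subseteq> {1..n}"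
    using t(1) unfolding Y_def signed_iff by blast
  ultimately obtain p where p: "p permutes {1..n}" "\<And>i. i \<in> Y \<Longrightarrow> p i = nat \<bar>t (int i)\<bar>"
    using extend_to_permutation[OF finite_atLeastAtMost Y] by blast
  obtain g where g: "g \<in> weyl_B n x" "\<And>i. i \<in> {1..n} \<Longrightarrow>
      g (x i) = (if i \<in> {i \<in> Y. t (int i) < 0} then - x (p i) else x (p i))"
    using weyl_B_realizes_signed_permutation[OF p(1), of "{i \<in> Y. t (int i) < 0}"] Y by blast
  have g_minus: "g (- v) = - g v" for v
    using weyl_B_linear[OF g(1)] by (rule linear_neg)
  have g_pos: "g (x i) = signed_vector x (t (int i))" if "i \<in> Y" for i
  proof -
    have "t (int i) \<noteq> 0"
      using t(1)[of "int i"] that by (auto simp: Y_def signed_iff)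
    then show ?thesis
      using that Y g(2) p(2) by (auto simp: signed_vector_def sgn_if)
  qed
  have g_t: "g (signed_vector x k) = signed_vector x (t k)" if k: "k \<in> signed Y" for k
  proof -
    have i: "nat \<bar>k\<bar> \<in> Y" "k \<noteq> 0"
      using k Y by (auto simp: signed_iff)
    show ?thesis
    proof (cases "0 < k")
      case True
      then show ?thesis
        using g_pos[OF i(1)] by (simp add: signed_vector_def)
    next
      case False
      then have "g (signed_vector x k) = - signed_vector x (t (- k))"
        using g_pos[OF i(1)] i(2) by (simp add: signed_vector_def[of x k] g_minus)
      also have "\<dots> = signed_vector x (t k)"
        using t_minus[of k] k signed_Y by (simp add: signed_vector_minus)
      finally show ?thesis .
    qed
  qed
  have "?\<phi> (restriction g (span (x ` Y))) = restriction t (signed Y)"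
    using Y t(1) g_t signed_Y by (intro frame_transport_signed_coordinate_subspace) auto
  also have "\<dots> = \<sigma>"
    using t(2) unfolding signed_Y by (auto simp: fun_eq_iff restriction_apply domIff)
  finally have "\<sigma> = ?\<phi> (restriction g (span (x ` Y)))" ..
  then show "\<sigma> \<in> ?\<phi> ` ?M"
    using g(1) Y unfolding boolean_system_B by blast
qed

lemma boolean_monoid_B_iso:
  "monoid_iso (boolean_monoid_B n x) (signed_perm_monoid n)
     (frame_transport (signed_vector x) (signed {1..n}))"
  unfolding boolean_monoid_B_def signed_perm_monoid_def
proof (rule reflection_monoid_iso[OF inj_signed_vector])
  show "id \<in> weyl_B n x"
    unfolding weyl_B_def by (rule generate_reflections_id)
  show "g -` Z \<in> boolean_system (weyl_B n x) n x"
    if "g \<in> weyl_B n x" "Z \<in> boolean_system (weyl_B n x) n x" for g Z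
    using boolean_system_preimage[OF weyl_B_generators] that unfolding weyl_B_def by blast
  show "span (Z \<inter> signed_vector x ` signed {1..n}) = Z"
    if Z: "Z \<in> boolean_system (weyl_B n x) n x" for Z
  proof -
    obtain Y where Y: "Y \<subseteq> {1..n}" "Z = span (x ` Y)"
      using Z unfolding boolean_system_B by blast
    then have "x ` Y \<subseteq> signed_vector x ` signed {1..n}"
      using signed_vector_image by blast
    then show ?thesis
      unfolding Y(2) by (rule span_Int_frame)
  qed
qed (fact boolean_system.whole boolean_system.inter boolean_monoid_B_image weyl_B_comp
    weyl_B_linear weyl_B_signed_frame)+

section \<open>The images of the generators\<close>

lemma transport_simple_reflection_A:
  assumes "{i, i + 1} \<subseteq> Y" "Y \<subseteq> {1..n}"
  shows "frame_transport x {1..n} (restriction (reflection (x i - x (i + 1))) (span (x ` Y))) =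
    sigma_perm i Y"
  unfolding sigma_perm_def
proof (rule frame_transport_coordinate_subspace[OF assms(2)])
  fix k assume "k \<in> Y"
  then have "i \<in> {1..n}" "i + 1 \<in> {1..n}" "k \<in> {1..n}" using assms by auto
  then show "Transposition.transpose i (i + 1) k \<in> {1..n} \<and>
      reflection (x i - x (i + 1)) (x k) = x (Transposition.transpose i (i + 1) k)"
    by (subst reflection_difference) (auto simp: Transposition.transpose_def)
qed

lemma reflection_signed_vector:
  "reflection a (signed_vector x k) = of_int (sgn k) *\<^sub>R reflection a (x (nat \<bar>k\<bar>))"
  unfolding signed_vector_def
  by (intro linear_scale orthogonal_transformation_linear orthogonal_transformation_reflection)

lemma transport_sign_change_B:
  assumes "i \<in> Y" "Y \<subseteq> {1..n}"
  shows "frame_transport (signed_vector x) (signed {1..n})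
      (restriction (reflection (x i)) (span (x ` Y))) = tau_perm i Y"
  unfolding tau_perm_def
proof (rule frame_transport_signed_coordinate_subspace[OF assms(2)])
  fix k assume "k \<in> signed Y"
  then have k: "i \<in> {1..n}" "nat \<bar>k\<bar> \<in> {1..n}" using assms by (auto simp: signed_iff)
  have "k = int i \<or> k = - int i \<or> nat \<bar>k\<bar> \<noteq> i" by linarith
  then show "Transposition.transpose (int i) (- int i) k \<in> signed {1..n} \<and>
      reflection (x i) (signed_vector x k) =
        signed_vector x (Transposition.transpose (int i) (- int i) k)"
    using k unfolding reflection_signed_vector
    by (auto simp: reflection_basis Transposition.transpose_def signed_iff signed_vector_def)
qed

lemma transport_simple_reflection_B:
  assumes "{i, i + 1} \<subseteq> Y" "Y \<subseteq> {1..n}"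
  shows "frame_transport (signed_vector x) (signed {1..n})
      (restriction (reflection (x i - x (i + 1))) (span (x ` Y))) = mu_perm i Y"
  unfolding mu_perm_def
proof (rule frame_transport_signed_coordinate_subspace[OF assms(2)])
  fix k assume "k \<in> signed Y"
  then have k: "i \<in> {1..n}" "i + 1 \<in> {1..n}" "nat \<bar>k\<bar> \<in> {1..n}"
    using assms by (auto simp: signed_iff)
  let ?t = "Transposition.transpose (int i) (int i + 1) \<circ>
      Transposition.transpose (- int i) (- (int i + 1))"
  \<comment> \<open>The two transpositions in \<open>?t\<close> move disjoint pairs, which have different signs, so \<open>?t\<close> keeps
    the sign and transposes the absolute value.\<close>
  have "k = int i \<or> k = int i + 1 \<or> k = - int i \<or> k = - (int i + 1) \<or>
      nat \<bar>k\<bar> \<noteq> i \<and> nat \<bar>k\<bar> \<noteq> i + 1"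
    by linarith
  then have "nat \<bar>?t k\<bar> = Transposition.transpose i (i + 1) (nat \<bar>k\<bar>) \<and> sgn (?t k) = sgn k"
    using k(1) by (elim disjE) (auto simp: Transposition.transpose_def nat_add_distrib)
  moreover have "Transposition.transpose i (i + 1) (nat \<bar>k\<bar>) \<in> {1..n}"
    using k by (auto simp: Transposition.transpose_def)
  ultimately show "?t k \<in> signed {1..n} \<and>
      reflection (x i - x (i + 1)) (signed_vector x k) = signed_vector x (?t k)"
    using k unfolding signed_iff signed_vector_def[of x "?t k"] reflection_signed_vector
    by (subst reflection_difference) auto
qed

end

theorem proposition12:
  fixes n :: nat and x :: "nat \<Rightarrow> 'a::euclidean_space"
  assumes "n \<ge> 2" and "orthonormal_basis n x"
  shows "(\<exists>\<phi>. monoid_iso (boolean_monoid_A n x) (symmetric_inverse_monoid n) \<phi> \<and>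
            (\<forall>i Y. 1 \<le> i \<and> i \<le> n - 1 \<and> {i, i + 1} \<subseteq> Y \<and> Y \<subseteq> {1..n} \<longrightarrow>
               \<phi> (restriction (reflection (x i - x (i + 1))) (span (x ` Y))) = sigma_perm i Y)) \<and>
         (\<exists>\<phi>. monoid_iso (boolean_monoid_B n x) (signed_perm_monoid n) \<phi> \<and>
            (\<forall>i Y. i \<in> Y \<and> Y \<subseteq> {1..n} \<longrightarrow>
               \<phi> (restriction (reflection (x i)) (span (x ` Y))) = tau_perm i Y) \<and>
            (\<forall>i Y. 1 \<le> i \<and> i \<le> n - 1 \<and> {i, i + 1} \<subseteq> Y \<and> Y \<subseteq> {1..n} \<longrightarrow>
               \<phi> (restriction (reflection (x i - x (i + 1))) (span (x ` Y))) = mu_perm i Y))"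
proof (intro conjI exI)
  show "monoid_iso (boolean_monoid_A n x) (symmetric_inverse_monoid n)
      (frame_transport x {1..n})"
    by (rule boolean_monoid_A_iso[OF assms(2)])
  show "monoid_iso (boolean_monoid_B n x) (signed_perm_monoid n)
      (frame_transport (signed_vector x) (signed {1..n}))"
    by (rule boolean_monoid_B_iso[OF assms(2)])
qed (simp_all add: transport_simple_reflection_A[OF assms(2)] transport_sign_change_B[OF assms(2)]
    transport_simple_reflection_B[OF assms(2)] del: One_nat_def)

end
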